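(* Let $(a_n)_{n\ge1}$ be the Hofstadter consecutive-sum sequence. Then \[ a_n\ge n+\frac{\log\log n}{\log 20}-O(1), \] i.e. there exists a constant $C>0$ such that $a_n\ge n+\frac{\log\log n}{\log 20}-C$ for all sufficiently large $n$.
   Context: The Hofstadter consecutive-sum sequence $(a_n)_{n\ge1}$ is the strictly increasing integer sequence defined by $a_1=1$, $a_2=2$, and, for $k\ge3$, by taking $a_k$ to be the least integer greater than $a_{k-1}$ that can be written as $\sum_{i=p}^{q}a_i$ for some integers $1\le p<q\le k-1$ (a sum of at least two consecutive earlier terms). Here $\log$ is the natural logarithm. *)

theory Defs
  imports Complex_Main
begin

context
  notes conj_cong [fundef_cong]
begin

(* Indexing starts at 1 as in the definition of the sequence; index 0 is outside
   the sequence and gets the dummy value 0, which is never used because p >= 1. *)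
fun hofstadter :: "nat \<Rightarrow> nat" where
  "hofstadter k =
     (if k = 0 then 0 else if k = 1 then 1 else if k = 2 then 2
      else (LEAST m. hofstadter (k - 1) < m \<and>
              (\<exists>p q. 1 \<le> p \<and> p < q \<and> q \<le> k - 1 \<and> m = (\<Sum>i = p..q. hofstadter i))))"

end

declare hofstadter.simps [simp del]

lemma hofstadter_1: "hofstadter 1 = 1"
  and hofstadter_2: "hofstadter 2 = 2"
  by (simp_all add: hofstadter.simps)

lemma hofstadter_pos: "1 \<le> k \<Longrightarrow> 0 < hofstadter k"
  and hofstadter_candidate:
    "3 \<le> k \<Longrightarrow> \<exists>m. hofstadter (k - 1) < m \<and>
       (\<exists>p q. 1 \<le> p \<and> p < q \<and> q \<le> k - 1 \<and> m = (\<Sum>i = p..q. hofstadter i))"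
  and hofstadter_least:
    "3 \<le> k \<Longrightarrow> hofstadter k = (LEAST m. hofstadter (k - 1) < m \<and>
       (\<exists>p q. 1 \<le> p \<and> p < q \<and> q \<le> k - 1 \<and> m = (\<Sum>i = p..q. hofstadter i)))"
proof -
  let ?P = "\<lambda>k m. hofstadter (k - 1) < m \<and>
       (\<exists>p q. 1 \<le> p \<and> p < q \<and> q \<le> k - 1 \<and> m = (\<Sum>i = p..q. hofstadter i))"
  have least: "hofstadter k = (LEAST m. ?P k m)" if "3 \<le> k" for k
    using that by (subst hofstadter.simps) simp
  have cand: "\<exists>m. ?P k m" if k: "3 \<le> k" and pos: "0 < hofstadter (k - 2)" for k
  proof -
    obtain j where j: "k = j + 3" using k by (metis le_add_diff_inverse2)
    have "hofstadter (k - 1) < (\<Sum>i = j + 1..j + 2. hofstadter i)"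
      using pos by (simp add: j)
    moreover have "1 \<le> j + 1 \<and> j + 1 < j + 2 \<and> j + 2 \<le> k - 1" by (simp add: j)
    ultimately have "?P k (\<Sum>i = j + 1..j + 2. hofstadter i)" by blast
    then show ?thesis ..
  qed
  have pos: "0 < hofstadter k" if "1 \<le> k" for k
    using that
  proof (induction k rule: less_induct)
    case (less k)
    show ?case
    proof (cases "3 \<le> k")
      case True
      then have "0 < hofstadter (k - 2)" using less.IH by simp
      then have "?P k (LEAST m. ?P k m)" by (rule LeastI_ex[OF cand[OF True]])
      then have "hofstadter (k - 1) < (LEAST m. ?P k m)" by (rule conjunct1)
      then show ?thesis unfolding least[OF True] by (rule le_less_trans[OF le0])
    next
      case False
      then have "k = 1 \<or> k = 2" using less.prems by auto
      then show ?thesis using hofstadter_1 hofstadter_2 by auto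
    qed
  qed
  show "1 \<le> k \<Longrightarrow> 0 < hofstadter k" by (rule pos)
  show "3 \<le> k \<Longrightarrow> \<exists>m. ?P k m" using cand[of k] pos[of "k - 2"] by simp
  show "3 \<le> k \<Longrightarrow> hofstadter k = (LEAST m. ?P k m)" by (rule least)
qed

lemma hofstadter_strict_mono: "strict_mono_on {1..} hofstadter"
proof -
  have step: "hofstadter k < hofstadter (Suc k)" if "1 \<le> k" for k
  proof (cases "k = 1")
    case True
    then show ?thesis using hofstadter_1 hofstadter_2 by (simp add: numeral_2_eq_2)
  next
    case False
    then have k: "3 \<le> Suc k" using that by simp
    have "hofstadter (Suc k - 1) < hofstadter (Suc k)"
      unfolding hofstadter_least[OF k]
      by (rule conjunct1[OF LeastI_ex[OF hofstadter_candidate[OF k]]])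
    then show ?thesis by simp
  qed
  show ?thesis
  proof (rule strict_mono_onI)
    fix m n :: nat assume "m \<in> {1..}" "n \<in> {1..}" "m < n"
    from \<open>m < n\<close> show "hofstadter m < hofstadter n"
    proof (induction n)
      case (Suc n)
      then show ?case using step[of n] \<open>m \<in> {1..}\<close>
        by (cases "m = n") auto
    qed simp
  qed
qed

end

(* A run of consecutive integers M, ..., X in the sequence with M = 2^r and X = 2^(4r-1) is
   impossible, because X itself has no representation. A sum of at least two consecutive integers
   is not a power of two; a sum of terms below M is too small; and a sum that starts below M and
   ends at v >= M forces M^4 <= v(v+1) < M^4 + M^2 because 2X = M^4, while v(v+1) jumps from below
   M^4 to at least M^4 + M^2 at v = M^2. So each interval [2^(4^i), 2^(4^(i+1))) contains an integer
   that is not in the sequence, and a_n - n counts such integers up to a_n. *)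

theory Submission
  imports Defs
begin

lemma hofstadter_less_iff:
  assumes "1 \<le> i" "1 \<le> j"
  shows "hofstadter i < hofstadter j \<longleftrightarrow> i < j"
  using strict_mono_on_less[OF hofstadter_strict_mono] assms by simp

lemma hofstadter_le_iff:
  assumes "1 \<le> i" "1 \<le> j"
  shows "hofstadter i \<le> hofstadter j \<longleftrightarrow> i \<le> j"
  using hofstadter_less_iff[OF assms(2,1)] by (simp add: not_less[symmetric])

lemma inj_on_hofstadter: "inj_on hofstadter {1..}"
  using hofstadter_strict_mono by (rule strict_mono_on_imp_inj_on)

lemma hofstadter_ge_index: "n \<le> hofstadter n"
proof (induction n)
  case (Suc n)
  show ?case
  proof (cases "n = 0")
    case False
    then have "hofstadter n < hofstadter (Suc n)" by (simp add: hofstadter_less_iff)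
    with Suc show ?thesis by simp
  qed (use hofstadter_1 in simp)
qed simp

text \<open>Monotonicity turns a block of indices into a range of values, so a sum of consecutive
  terms becomes the sum of all terms lying between two values.\<close>

lemma hofstadter_image_interval:
  assumes "1 \<le> p" "1 \<le> q"
  shows "hofstadter ` {p..q} = hofstadter ` {1..} \<inter> {hofstadter p..hofstadter q}"
  using assms by (auto simp: hofstadter_le_iff)

lemma hofstadter_representation:
  assumes "x \<in> hofstadter ` {1..}" "3 \<le> x"
  obtains p q where "1 \<le> p" "p < q" "x = (\<Sum>i = p..q. hofstadter i)"
proof -
  obtain k where k: "1 \<le> k" "x = hofstadter k" using assms(1) by auto
  have "k \<noteq> 1" "k \<noteq> 2" using k(2) assms(2) hofstadter_1 hofstadter_2 by auto
  then have "3 \<le> k" using k(1) by simp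
  from LeastI_ex[OF hofstadter_candidate[OF this]] that show ?thesis
    unfolding hofstadter_least[OF \<open>3 \<le> k\<close>, symmetric] k(2) by blast
qed

text \<open>With \<open>v = u + d\<close>, twice the sum is \<open>(2 * u + d) * (d + 1)\<close>.
  Both factors exceed 1 and they have opposite parity, but every divisor of a power of two other
  than 1 is even.\<close>

lemma sum_interval_not_power_of_two:
  fixes u v :: nat
  assumes "0 < u" "u < v"
  shows "\<Sum>{u..v} \<noteq> 2 ^ k"
proof
  assume eq: "\<Sum>{u..v} = 2 ^ k"
  obtain d where v: "v = u + d" "0 < d" using assms by (metis less_imp_add_positive)
  have "2 * \<Sum>{u..u + d} = (2 * u + d) * (d + 1)"
    by (induction d) (auto simp: algebra_simps)
  then have prod: "(2 * u + d) * (d + 1) = 2 ^ (k + 1)" using eq v by simp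
  have pow: "even x" if "x dvd 2 ^ (k + 1)" "1 < x" for x :: nat
  proof (rule ccontr)
    assume "odd x"
    then have "coprime x (2 ^ (k + 1))" by simp
    from coprime_common_divisor[OF this dvd_refl that(1)] that(2) show False by simp
  qed
  have "even (2 * u + d)"
    using assms(1) v(2) by (intro pow dvdI[OF prod[symmetric]]) simp
  moreover have "even (d + 1)"
    using v(2) by (intro pow dvdI[OF prod[symmetric, unfolded mult.commute[of _ "d + 1"]]]) simp
  ultimately show False by simp
qed

lemma hofstadter_gap:
  assumes "1 \<le> r"
  shows "\<exists>x. 2 ^ r \<le> x \<and> x < 2 ^ (4 * r) \<and> x \<notin> hofstadter ` {1..}"
proof (rule ccontr)
  define M :: nat where "M = 2 ^ r"
  define X :: nat where "X = 2 ^ (4 * r - 1)"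
  have M: "2 \<le> M" using assms unfolding M_def by (simp add: self_le_power)
  have "2 * X = 2 ^ Suc (4 * r - 1)" unfolding X_def by simp
  also have "\<dots> = 2 ^ (r * 4)" using assms by (simp add: mult.commute)
  also have "\<dots> = M ^ 4" by (simp add: M_def power_mult)
  finally have X: "2 * X = M ^ 4" .
  have "2 ^ 2 \<le> M ^ 2" using M by (rule power_mono) simp
  then have "4 * M ^ 2 \<le> M ^ 2 * M ^ 2" by (intro mult_right_mono) simp_all
  also have "\<dots> = 2 * X" by (simp add: X flip: power_add)
  finally have sq: "4 * M ^ 2 \<le> 2 * X" .
  have "X < 2 ^ (4 * r)" unfolding X_def using assms by simp
  moreover assume "\<not> ?thesis"
  ultimately have run: "{M..X} \<subseteq> hofstadter ` {1..}" by (force simp: M_def)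
  have "M \<le> M ^ 2" by (simp add: power2_eq_square)
  then have "M \<le> X" "3 \<le> X" using sq M by linarith+
  then have "X \<in> hofstadter ` {1..}" using run by (meson atLeastAtMost_iff order_refl subsetD)
  from hofstadter_representation[OF this \<open>3 \<le> X\<close>]
  obtain p q where pq: "1 \<le> p" "p < q" "X = (\<Sum>i = p..q. hofstadter i)" .
  define u where "u = hofstadter p"
  define v where "v = hofstadter q"
  define B where "B = hofstadter ` {p..q}"
  have B: "B = hofstadter ` {1..} \<inter> {u..v}"
    unfolding B_def u_def v_def using pq by (intro hofstadter_image_interval) auto
  have "X = \<Sum>B" unfolding B_def using pq
    by (subst sum.reindex[OF inj_on_subset[OF inj_on_hofstadter]]) auto
  have fin: "finite B" by (simp add: B_def)
  have "v \<in> B" using pq by (simp add: B_def v_def)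
  then have "v \<le> X" using member_le_sum[of v B "\<lambda>x. x"] fin by (simp add: \<open>X = \<Sum>B\<close>)
  have uv: "0 < u" "u < v" using pq by (simp_all add: u_def v_def hofstadter_less_iff hofstadter_pos)
  \<comment> \<open>\<open>S\<close> is the part of the representation below \<open>M\<close>, where
    nothing is known about which integers occur; only the bound by the sum of all integers below
    \<open>M\<close> is available.\<close>
  define S where "S = \<Sum>(B \<inter> {..<M})"
  have "S \<le> \<Sum>{..<M}" unfolding S_def by (intro sum_mono2) auto
  moreover have tri: "2 * \<Sum>{..<n} + n = n ^ 2" for n :: nat
    by (induction n) (auto simp: power2_eq_square)
  ultimately have S: "2 * S + M \<le> M ^ 2" using tri[of M] by linarith
  \<comment> \<open>The summands lie entirely inside the run, entirely below it, or straddle its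
    start \<open>M\<close>.\<close>
  consider "M \<le> u" | "v < M" | "u < M" "M \<le> v" by linarith
  then show False
  proof cases
    case 1
    then have "B = {u..v}" using run \<open>v \<le> X\<close> by (auto simp: B)
    then show False using sum_interval_not_power_of_two[OF uv] \<open>X = \<Sum>B\<close> X_def by metis
  next
    case 2
    then have "B \<inter> {..<M} = B" by (auto simp: B)
    then show False using S sq M \<open>X = \<Sum>B\<close> by (simp add: S_def)
  next
    case 3
    then have "B = (B \<inter> {..<M}) \<union> {M..v}" using run \<open>v \<le> X\<close> by (auto simp: B)
    then have "\<Sum>B = S + \<Sum>{M..v}" unfolding S_def
      using fin by (subst sum.union_disjoint[symmetric]) auto
    moreover have "{..<Suc v} = {..<M} \<union> {M..v}" using 3 by auto
    then have "\<Sum>{..<Suc v} = \<Sum>{..<M} + \<Sum>{M..v}"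
      by (rule ssubst) (rule sum.union_disjoint, auto)
    ultimately have "2 * X + M ^ 2 + Suc v = 2 * S + M + Suc v ^ 2"
      using tri[of M] tri[of "Suc v"] \<open>X = \<Sum>B\<close> by linarith
    \<comment> \<open>Since \<open>2 * S + M\<close> is positive and at most \<open>M ^ 2\<close>,
      this confines \<open>v * (v + 1)\<close> to the window from \<open>M ^ 4\<close> up to, but
      excluding, \<open>M ^ 4 + M ^ 2\<close>. The two steps below show that no \<open>v\<close>
      fits.\<close>
    then have eq: "M ^ 4 + M ^ 2 = 2 * S + M + v * (v + 1)"
      by (simp add: X power2_eq_square)
    have "M ^ 2 \<le> v"
    proof (rule ccontr)
      assume "\<not> M ^ 2 \<le> v"
      then have "v * (v + 1) < M ^ 2 * M ^ 2"
        by (intro mult_less_le_imp_less) auto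
      then show False using eq S by (simp flip: power_add)
    qed
    then have "M ^ 2 * (M ^ 2 + 1) \<le> v * (v + 1)" by (intro mult_mono) auto
    then have "M ^ 4 + M ^ 2 \<le> v * (v + 1)" by (simp add: algebra_simps flip: power_add)
    then show False using eq M by linarith
  qed
qed

text \<open>The exponent ranges between successive powers of 4 supply \<open>m\<close> distinct
  missing values, all below \<open>2 ^ 4 ^ m\<close> and hence at most \<open>hofstadter n\<close>.
  Together with the first \<open>n\<close> terms they are \<open>n + m\<close> distinct elements of
  \<open>{1..hofstadter n}\<close>.\<close>

lemma hofstadter_ge_index_add:
  assumes "2 ^ 4 ^ m \<le> n"
  shows "n + m \<le> hofstadter n"
proof -
  have n: "1 \<le> n" using assms by (rule order_trans[rotated]) simp
  have "\<exists>x. 2 ^ 4 ^ i \<le> x \<and> x < 2 ^ 4 ^ Suc i \<and> x \<notin> hofstadter ` {1..}" for i :: nat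
    using hofstadter_gap[of "4 ^ i"] by simp
  then obtain f where f: "2 ^ 4 ^ i \<le> f i" "f i < 2 ^ 4 ^ Suc i" "f i \<notin> hofstadter ` {1..}"
    for i :: nat by metis
  have "strict_mono f" using less_le_trans[OF f(2) f(1)] by (simp add: strict_mono_Suc_iff)
  have "f ` {..<m} \<subseteq> {1..hofstadter n}"
  proof safe
    fix i assume "i < m"
    have "f i < 2 ^ 4 ^ Suc i" by (rule f)
    also have "\<dots> \<le> 2 ^ 4 ^ m" using \<open>i < m\<close> by (intro power_increasing) auto
    also have "\<dots> \<le> hofstadter n" using assms hofstadter_ge_index by (rule order_trans)
    finally show "f i \<in> {1..hofstadter n}" using f(1)[of i] by (simp add: order_trans[rotated])
  qed
  moreover have "hofstadter ` {1..n} \<subseteq> {1..hofstadter n}"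
    using hofstadter_pos n by (auto simp: hofstadter_le_iff Suc_le_eq)
  ultimately have "card (hofstadter ` {1..n} \<union> f ` {..<m}) \<le> card {1..hofstadter n}"
    by (intro card_mono) auto
  also have "card (hofstadter ` {1..n} \<union> f ` {..<m})
      = card (hofstadter ` {1..n}) + card (f ` {..<m})"
    using f(3) by (intro card_Un_disjoint) force+
  also have "\<dots> = n + m"
    using inj_on_subset[OF inj_on_hofstadter, of "{1..n}"]
      inj_on_subset[OF strict_mono_imp_inj_on[OF \<open>strict_mono f\<close>], of "{..<m}"]
    by (subst (1 2) card_image) auto
  finally show ?thesis by simp
qed

text \<open>Each missing value costs a factor 4 in the exponent, hence the denominator
  \<open>ln 4\<close>; the loss of 1 accounts for the last range, which \<open>n\<close> need not
  exhaust.\<close>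

lemma hofstadter_lower_bound:
  assumes "3 \<le> n"
  shows "real n + ln (ln (real n)) / ln 4 - 1 \<le> real (hofstadter n)"
proof -
  have "\<exists>m. n < 2 ^ 4 ^ m"
  proof
    have "n < 4 ^ n" by (rule less_le_trans[OF less_exp power_mono]) auto
    also have "(4::nat) ^ n < 2 ^ 4 ^ n" by (rule less_exp)
    finally show "n < 2 ^ 4 ^ n" .
  qed
  \<comment> \<open>Leastness of \<open>m\<close> puts \<open>n\<close> at or above
    \<open>2 ^ 4 ^ (m - 1)\<close> when \<open>m\<close> is positive, while
    \<open>n < 2 ^ 4 ^ m\<close> bounds the iterated logarithm from above.\<close>
  define m where "m = (LEAST m. n < 2 ^ 4 ^ m)"
  have m: "n < 2 ^ 4 ^ m" unfolding m_def by (rule LeastI_ex) fact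
  have "n + (m - 1) \<le> hofstadter n"
  proof (cases m)
    case (Suc k)
    then have "\<not> n < 2 ^ 4 ^ k" unfolding m_def by (intro not_less_Least) simp
    then show ?thesis using Suc by (simp add: hofstadter_ge_index_add)
  qed (simp add: hofstadter_ge_index)
  then have bound: "real n + real m - 1 \<le> real (hofstadter n)" by linarith
  have pos: "0 < ln (real n)" using assms by simp
  have "real n < 2 ^ 4 ^ m" using m by (metis of_nat_less_iff of_nat_numeral of_nat_power)
  then have "ln (real n) < ln (2 ^ 4 ^ m)" using assms by (subst ln_less_cancel_iff) auto
  also have "\<dots> = 4 ^ m * ln 2" by (simp add: ln_realpow)
  also have "\<dots> \<le> 4 ^ m" using ln_le_minus_one[of 2] by simp
  finally have "ln (ln (real n)) \<le> ln (4 ^ m)" using pos by (subst ln_le_cancel_iff) auto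
  then have "ln (ln (real n)) / ln 4 \<le> real m" by (simp add: ln_realpow divide_le_eq)
  with bound show ?thesis by linarith
qed

theorem theorem1p4:
  "\<exists>C::real. C > 0 \<and>
     (\<forall>\<^sub>F n in sequentially.
        real (hofstadter n) \<ge> real n + ln (ln (real n)) / ln 20 - C)"
proof (intro exI[of _ 1] conjI eventually_sequentiallyI[of 3])
  fix n :: nat assume n: "3 \<le> n"
  \<comment> \<open>From \<open>n = 3\<close> on, the iterated logarithm is nonnegative, so
    replacing \<open>ln 4\<close> by the larger \<open>ln 20\<close> can only lower the
    quotient.\<close>
  have "exp 1 \<le> real n" using exp_le n by linarith
  then have "1 \<le> ln (real n)" using n by (subst ln_ge_iff) auto
  then have "ln (ln (real n)) / ln 20 \<le> ln (ln (real n)) / ln 4"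
    by (intro divide_left_mono) auto
  then show "real n + ln (ln (real n)) / ln 20 - 1 \<le> real (hofstadter n)"
    using hofstadter_lower_bound[OF n] by linarith
qed simp

end
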